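(* Let $A = s_0\xrightarrow{e_1}s_1\xrightarrow{e_2}\cdots\xrightarrow{e_t}s_t$ be a linear $2$-fold transition system. Then $A$ has the state separation property if and only if $A$ has no exact 2-fold subsequence.
   Context: A linear transition system is given by a sequence $A = s_0\xrightarrow{e_1}s_1\xrightarrow{e_2}\cdots\xrightarrow{e_t}s_t$ of pairwise distinct states $s_0,\dots,s_t$ and events $e_1,\dots,e_t$ (not necessarily distinct); its edges are exactly $s_{i-1}\xrightarrow{e_i}s_i$ for $i\in\{1,\dots,t\}$, its event set is $\{e_1,\dots,e_t\}$ and $s_0$ is the initial state. It is $2$-fold if every event labels at most two edges. A set $R$ of states is a region if there is a signature $sig_R$ mapping events to $\{-1,0,1\}$ with $R(s_i)=R(s_{i-1})+sig_R(e_i)$ for all $i\in\{1,\dots,t\}$, where $R(s)=1$ if $s\in R$ and $0$ otherwise. $A$ has the state separation property if for all distinct states $s,s'$ there is a region $R$ with $R(s)\neq R(s')$. For $0\leq i<j\leq t$, the subsequence $A^i_j$ is $s_i\xrightarrow{e_{i+1}}\cdots\xrightarrow{e_j}s_j$; it is an exact 2-fold subsequence if every event occurring in the list $e_{i+1},\dots,e_j$ occurs in that list exactly twice. *)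

theory Defs
  imports Main
begin

text \<open>
  A linear transition system \<open>s\<^sub>0 \<longrightarrow> \<dots> \<longrightarrow> s\<^sub>t\<close> is given by its list of states
  \<open>S = [s\<^sub>0, \<dots>, s\<^sub>t]\<close> and its list of events \<open>E = [e\<^sub>1, \<dots>, e\<^sub>t]\<close>.  Lists are indexed from 0,
  so \<open>s\<^sub>i\<close> is \<open>S ! i\<close> whereas \<open>e\<^sub>i\<close> is \<open>E ! (i - 1)\<close>.
\<close>

definition linear_ts :: "'s list \<Rightarrow> 'e list \<Rightarrow> bool" where
  "linear_ts S E \<longleftrightarrow> length S = length E + 1 \<and> distinct S"

definition edges :: "'s list \<Rightarrow> 'e list \<Rightarrow> ('s \<times> 'e \<times> 's) set" where
  "edges S E = {(S ! (i - 1), E ! (i - 1), S ! i) | i. i \<in> {1..length E}}"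

definition two_fold :: "'s list \<Rightarrow> 'e list \<Rightarrow> bool" where
  "two_fold S E \<longleftrightarrow> (\<forall>e\<in>set E. card {(s, s'). (s, e, s') \<in> edges S E} \<le> 2)"

definition region :: "'s list \<Rightarrow> 'e list \<Rightarrow> 's set \<Rightarrow> bool" where
  "region S E R \<longleftrightarrow> R \<subseteq> set S \<and>
     (\<exists>sig :: 'e \<Rightarrow> int. (\<forall>e\<in>set E. sig e \<in> {-1, 0, 1}) \<and>
        (\<forall>i\<in>{1..length E}.
           of_bool (S ! i \<in> R) = of_bool (S ! (i - 1) \<in> R) + sig (E ! (i - 1))))"

definition state_separation_property :: "'s list \<Rightarrow> 'e list \<Rightarrow> bool" where
  "state_separation_property S E \<longleftrightarrow>
     (\<forall>s\<in>set S. \<forall>s'\<in>set S. s \<noteq> s' \<longrightarrow>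
        (\<exists>R. region S E R \<and> (of_bool (s \<in> R) :: int) \<noteq> of_bool (s' \<in> R)))"

text \<open>The event list \<open>[e\<^sub>i\<^sub>+\<^sub>1, \<dots>, e\<^sub>j]\<close> of the subsequence from \<open>s\<^sub>i\<close> to \<open>s\<^sub>j\<close>.\<close>

definition subseq_events :: "'e list \<Rightarrow> nat \<Rightarrow> nat \<Rightarrow> 'e list" where
  "subseq_events E i j = take (j - i) (drop i E)"

definition exact_two_fold_subsequence :: "'e list \<Rightarrow> nat \<Rightarrow> nat \<Rightarrow> bool" where
  "exact_two_fold_subsequence E i j \<longleftrightarrow> i < j \<and> j \<le> length E \<and>
     (\<forall>e\<in>set (subseq_events E i j). count_list (subseq_events E i j) e = 2)"

end

theory Submission
  imports Defs
begin

text \<open>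
  A region changes its value between \<open>s\<^sub>i\<close> and \<open>s\<^sub>j\<close> by the sum of the signatures in between, which is
  even on an exact 2-fold subsequence; so the ends of such a subsequence are never separated.

  Conversely, fix \<open>i < j\<close>. If some event of the whole system occurs only once, and does so between
  \<open>s\<^sub>i\<close> and \<open>s\<^sub>j\<close>, it separates them on its own. Otherwise let \<open>M\<close> be the set of all positions of
  events occurring exactly once between \<open>s\<^sub>i\<close> and \<open>s\<^sub>j\<close>. The smallest interval containing \<open>M\<close> is not
  exact, so it contains an event \<open>f\<close> exactly once. One shows that this occurrence lies between the
  two occurrences of an event \<open>e\<close> with positions in \<open>M\<close>. The occurrences of \<open>e\<close> and \<open>f\<close> then
  alternate, so giving them opposite signatures yields a region. It separates \<open>s\<^sub>i\<close> from \<open>s\<^sub>j\<close>, since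
  \<open>e\<close> occurs once between them and \<open>f\<close> occurs zero or two times.
\<close>

section \<open>Occurrences of events as positions in the event list\<close>

definition at_most_twice :: "'e list \<Rightarrow> bool" where
  "at_most_twice E \<longleftrightarrow> (\<forall>k<length E. \<forall>l<length E. \<forall>m<length E.
     E ! k = E ! l \<longrightarrow> E ! l = E ! m \<longrightarrow> k = l \<or> l = m \<or> k = m)"

text \<open>Position \<open>p\<close> is the edge from \<open>S ! p\<close> to
  \<open>S ! Suc p\<close>, so the half-open range holds the edges between \<open>S ! i\<close> and
  \<open>S ! j\<close>.\<close>

definition lone :: "'e list \<Rightarrow> nat \<Rightarrow> nat \<Rightarrow> nat \<Rightarrow> bool" where
  "lone E i j p \<longleftrightarrow> i \<le> p \<and> p < j \<and> (\<forall>m. i \<le> m \<longrightarrow> m < j \<longrightarrow> E ! m = E ! p \<longrightarrow> m = p)"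

text \<open>The characteristic functions of regions, as functions of the index of the state.\<close>

definition compatible :: "'e list \<Rightarrow> (nat \<Rightarrow> bool) \<Rightarrow> bool" where
  "compatible E b \<longleftrightarrow> (\<forall>m<length E. \<forall>n<length E. E ! m = E ! n \<longrightarrow>
     (of_bool (b (Suc m)) - of_bool (b m) :: int) = of_bool (b (Suc n)) - of_bool (b n))"

lemma at_most_twiceD:
  assumes "at_most_twice E" "k < length E" "l < length E" "m < length E"
    and "E ! k = E ! l" "k \<noteq> l" "E ! m = E ! l"
  shows "m = k \<or> m = l"
  using assms unfolding at_most_twice_def by metis

text \<open>As the states are distinct, different positions give different edges, so three
  occurrences of an event would be three edges.\<close>

lemma two_fold_at_most_twice:
  assumes lin: "linear_ts S E" and two: "two_fold S E"
  shows "at_most_twice E"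
  unfolding at_most_twice_def
proof (intro allI impI, rule ccontr)
  fix k l m
  assume lt: "k < length E" "l < length E" "m < length E"
    and eq: "E ! k = E ! l" "E ! l = E ! m"
    and neq: "\<not> (k = l \<or> l = m \<or> k = m)"
  define F where "F = {(s, s'). (s, E ! m, s') \<in> edges S E}"
  let ?g = "\<lambda>n. (S ! n, S ! Suc n)"
  have inj: "inj_on ?g {..<length E}"
    using lin by (auto simp: inj_on_def linear_ts_def nth_eq_iff_index_eq)
  have g_in: "?g n \<in> F" if "n < length E" "E ! n = E ! m" for n
    unfolding F_def edges_def using that by (force intro!: exI[of _ "Suc n"])
  have "F \<subseteq> ?g ` {..<length E}"
  proof
    fix x assume "x \<in> F"
    then obtain i where "i \<in> {1..length E}" "x = (S ! (i - 1), S ! i)"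
      unfolding F_def edges_def by auto
    then show "x \<in> ?g ` {..<length E}"
      by (intro image_eqI[of _ _ "i - 1"]) auto
  qed
  then have fin: "finite F" using finite_surj by blast
  have "card (?g ` {k, l, m}) = card {k, l, m}"
    by (rule card_image, rule inj_on_subset[OF inj]) (use lt in auto)
  also have "card {k, l, m} = 3" using neq by auto
  finally have "3 \<le> card F"
    using card_mono[OF fin, of "?g ` {k, l, m}"] g_in lt eq by auto
  moreover have "card F \<le> 2"
    using two lt unfolding two_fold_def F_def by auto
  ultimately show False by simp
qed

text \<open>If no position is lone, each has a second occurrence within the segment; a third is
  excluded, so every count is 2.\<close>

lemma not_exact_imp_lone:
  assumes amt: "at_most_twice E" and ij: "i < j" "j \<le> length E"
    and "\<not> exact_two_fold_subsequence E i j"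
  shows "\<exists>p. lone E i j p"
proof (rule ccontr)
  assume no: "\<nexists>p. lone E i j p"
  let ?L = "subseq_events E i j"
  have len: "length ?L = j - i" and nth: "\<And>k. k < j - i \<Longrightarrow> ?L ! k = E ! (i + k)"
    using ij by (auto simp: subseq_events_def)
  have "count_list ?L e = 2" if "e \<in> set ?L" for e
  proof -
    obtain k where k: "k < j - i" "E ! (i + k) = e"
      using \<open>e \<in> set ?L\<close> len nth by (metis in_set_conv_nth)
    have "i + k < j" "\<not> lone E i j (i + k)" using no k(1) by auto
    then obtain n where n: "i \<le> n" "n < j" "E ! n = E ! (i + k)" "n \<noteq> i + k"
      unfolding lone_def by auto
    have "{m. m < length ?L \<and> e = ?L ! m} = {k, n - i}"
    proof (intro set_eqI iffI)
      fix m assume m: "m \<in> {m. m < length ?L \<and> e = ?L ! m}"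
      have "i + m = i + k \<or> i + m = n"
        using at_most_twiceD[OF amt, of "i + k" n "i + m"] m k n ij len nth by auto
      then show "m \<in> {k, n - i}" by auto
    next
      fix m assume "m \<in> {k, n - i}"
      then show "m \<in> {m. m < length ?L \<and> e = ?L ! m}"
        using k n len nth by auto
    qed
    moreover have "k \<noteq> n - i" using n by auto
    ultimately show ?thesis
      by (simp add: count_list_eq_length_filter length_filter_conv_card)
  qed
  then show False
    using assms unfolding exact_two_fold_subsequence_def by blast
qed

section \<open>Three shapes of regions\<close>

lemma compatible_single:
  assumes "lone E 0 (length E) q"
  shows "compatible E (\<lambda>k. q < k)"
  unfolding compatible_def
proof (intro allI impI)
  fix m n assume "m < length E" "n < length E" "E ! m = E ! n"
  then have "m = q \<longleftrightarrow> n = q" using assms unfolding lone_def by auto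
  then show "(of_bool (q < Suc m) - of_bool (q < m) :: int) = of_bool (q < Suc n) - of_bool (q < n)"
    by (cases "m = q") auto
qed

text \<open>The event at \<open>x\<close> and \<open>y\<close> gets signature 1, the one at
  \<open>q\<close> gets -1, all others 0: the value runs through 0, 1, 0, 1.\<close>

lemma compatible_triple:
  assumes amt: "at_most_twice E" and "lone E 0 (length E) q"
    and "x < q" "q < y" "y < length E" "E ! x = E ! y"
  shows "compatible E (\<lambda>k. x < k \<and> k \<le> q \<or> y < k)" (is "compatible E ?b")
proof -
  have occ: "m = n \<or> m = x \<and> n = y \<or> m = y \<and> n = x \<or> m \<notin> {x, y, q} \<and> n \<notin> {x, y, q}"
    if "m < length E" "n < length E" "E ! m = E ! n" for m n
    using that assms at_most_twiceD[OF amt, of x y m] at_most_twiceD[OF amt, of x y n]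
    unfolding lone_def by (metis insertE empty_iff less_trans zero_le order.strict_implies_not_eq)
  show ?thesis
    unfolding compatible_def
  proof (intro allI impI)
    fix m n assume "m < length E" "n < length E" "E ! m = E ! n"
    from occ[OF this] show "(of_bool (?b (Suc m)) - of_bool (?b m) :: int) =
        of_bool (?b (Suc n)) - of_bool (?b n)"
      by (elim disjE) (use assms(3,4) in \<open>auto simp: less_Suc_eq Suc_le_eq\<close>)
  qed
qed

text \<open>The event at \<open>x\<close> and \<open>y\<close> gets signature 1, the one at
  \<open>q\<close> and \<open>r\<close> gets -1; as they alternate, the value stays in {0,
  1}.\<close>

lemma compatible_crossing:
  assumes amt: "at_most_twice E"
    and "x < q" "q < y" "y < r" "r < length E" "E ! x = E ! y" "E ! q = E ! r"
  shows "compatible E (\<lambda>k. x < k \<and> k \<le> q \<or> y < k \<and> k \<le> r)" (is "compatible E ?b")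
proof -
  have occ: "m = n \<or> m = x \<and> n = y \<or> m = y \<and> n = x \<or> m = q \<and> n = r \<or> m = r \<and> n = q \<or>
      m \<notin> {x, y, q, r} \<and> n \<notin> {x, y, q, r}"
    if "m < length E" "n < length E" "E ! m = E ! n" for m n
    using that assms at_most_twiceD[OF amt, of x y m] at_most_twiceD[OF amt, of x y n]
      at_most_twiceD[OF amt, of q r m] at_most_twiceD[OF amt, of q r n]
    by auto
  have flat: "?b (Suc m) \<longleftrightarrow> ?b m" if "m \<notin> {x, y, q, r}" for m
    using that by (auto simp: less_Suc_eq Suc_le_eq le_less)
  show ?thesis
    unfolding compatible_def
  proof (intro allI impI)
    fix m n assume "m < length E" "n < length E" "E ! m = E ! n"
    from occ[OF this] show "(of_bool (?b (Suc m)) - of_bool (?b m) :: int) =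
        of_bool (?b (Suc n)) - of_bool (?b n)"
      by (elim disjE conjE) (use assms(2-4) in \<open>simp_all add: flat\<close>)
  qed
qed

section \<open>Separating two states when no subsequence is exact\<close>

lemma separating_compatible:
  assumes amt: "at_most_twice E" and ij: "i < j" "j \<le> length E"
    and no: "\<nexists>i j. exact_two_fold_subsequence E i j"
  shows "\<exists>b. compatible E b \<and> b i \<noteq> b j"
proof (cases "\<exists>q. lone E 0 (length E) q \<and> i \<le> q \<and> q < j")
  case True
  then show ?thesis using compatible_single by (metis leD less_le_trans)
next
  case False
  define M where "M = {m. m < length E \<and> (\<exists>p. lone E i j p \<and> E ! m = E ! p)}"
  have partner: "\<exists>n<length E. n \<noteq> p \<and> E ! n = E ! p" if "i \<le> p" "p < j" for p
    using False that ij unfolding lone_def by force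
  have "finite M" by (simp add: M_def)
  obtain p0 where "lone E i j p0" using not_exact_imp_lone amt ij no by blast
  then have "p0 \<in> M" using ij by (auto simp: M_def lone_def)
  have M_lt: "m < length E" if "m \<in> M" for m using that by (simp add: M_def)
  \<comment> \<open>An event that is lone in the segment occurs again by \<open>partner\<close>,
    necessarily outside it, and no third time. So \<open>M\<close> splits into pairs, each with one
    member inside.\<close>
  have pair: "\<exists>n\<in>M. n \<noteq> m \<and> E ! n = E ! m \<and> (i \<le> n \<and> n < j \<longleftrightarrow> \<not> (i \<le> m \<and> m < j))"
    if "m \<in> M" for m
  proof -
    obtain p where p: "lone E i j p" "E ! m = E ! p" "m < length E"
      using \<open>m \<in> M\<close> by (auto simp: M_def)
    obtain n where n: "n < length E" "n \<noteq> p" "E ! n = E ! p"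
      using partner p unfolding lone_def by blast
    have "m = n \<or> m = p"
      using at_most_twiceD[OF amt, of n p m] n p ij by (auto simp: lone_def)
    then show ?thesis
      using p n ij unfolding M_def lone_def by (auto intro: exI[of _ p] exI[of _ n])
  qed
  define P where "P = Min M"
  define Q where "Q = Max M"
  have PQ: "P \<in> M" "Q \<in> M" "\<And>m. m \<in> M \<Longrightarrow> P \<le> m \<and> m \<le> Q"
    using \<open>finite M\<close> \<open>p0 \<in> M\<close> unfolding P_def Q_def by (blast intro: Min_in Max_in Min_le Max_ge)+
  obtain r where r: "lone E P (Suc Q) r"
    using not_exact_imp_lone[OF amt, of P "Suc Q"] no PQ M_lt by (meson le_imp_less_Suc Suc_leI)
  have r_bounds: "P \<le> r" "r \<le> Q" "r < length E"
    using r M_lt[OF PQ(2)] by (auto simp: lone_def)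
  have r_lone: "n = r" if "P \<le> n" "n \<le> Q" "E ! n = E ! r" for n
    using r that by (auto simp: lone_def)
  \<comment> \<open>Otherwise its partner in \<open>M\<close> would be a second occurrence between
    \<open>P\<close> and \<open>Q\<close>.\<close>
  have "r \<notin> M"
    using pair r_lone PQ(3) by metis
  \<comment> \<open>If just one of \<open>n\<close> and \<open>r\<close> lay in the segment, it
    would be lone there, which would put \<open>r\<close> into \<open>M\<close>.\<close>
  have r_sides: "i \<le> n \<and> n < j \<longleftrightarrow> i \<le> r \<and> r < j"
    if n: "n < length E" "n \<noteq> r" "E ! n = E ! r" for n
  proof (rule ccontr)
    assume "\<not> ?thesis"
    then consider "i \<le> n" "n < j" "\<not> (i \<le> r \<and> r < j)" | "i \<le> r" "r < j" "\<not> (i \<le> n \<and> n < j)"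
      by blast
    then have "lone E i j n \<or> lone E i j r"
      using at_most_twiceD[OF amt, of n r] n r_bounds ij unfolding lone_def
      by cases (metis less_le_trans)+
    then show False using n r_bounds \<open>r \<notin> M\<close> unfolding M_def by auto
  qed
  \<comment> \<open>The pair of the minimum \<open>P\<close> or that of the maximum \<open>Q\<close>
    encloses \<open>r\<close>. Otherwise \<open>r\<close> and a second occurrence of its event would
    lie in the segment, hence between \<open>P\<close> and \<open>Q\<close>, where \<open>r\<close>
    is lone.\<close>
  obtain x y where xy: "x \<in> M" "y \<in> M" "x < r" "r < y" "E ! x = E ! y"
    and xy_sides: "i \<le> x \<and> x < j \<longleftrightarrow> \<not> (i \<le> y \<and> y < j)"
  proof -
    obtain P' where P': "P' \<in> M" "P' \<noteq> P" "E ! P' = E ! P"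
      "i \<le> P' \<and> P' < j \<longleftrightarrow> \<not> (i \<le> P \<and> P < j)" using pair PQ by blast
    obtain Q' where Q': "Q' \<in> M" "Q' \<noteq> Q" "E ! Q' = E ! Q"
      "i \<le> Q' \<and> Q' < j \<longleftrightarrow> \<not> (i \<le> Q \<and> Q < j)" using pair PQ by blast
    have ne: "r \<noteq> P" "r \<noteq> Q" "r \<noteq> P'" "r \<noteq> Q'" using \<open>r \<notin> M\<close> PQ P' Q' by auto
    show ?thesis
    proof (cases "r < P' \<or> Q' < r")
      case True
      then show ?thesis
      proof
        assume "r < P'"
        moreover have "P < r" using r_bounds ne by simp
        ultimately show ?thesis using that[of P P'] PQ(1) P' by simp
      next
        assume "Q' < r"
        moreover have "r < Q" using r_bounds ne by simp
        ultimately show ?thesis using that[of Q' Q] PQ(2) Q' by simp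
      qed
    next
      case outside: False
      \<comment> \<open>Both inner partners lie in the segment, so \<open>r\<close> does too, and hence so does its partner.\<close>
      have "i \<le> r" "r < j" "P < i" "j \<le> Q"
        using outside P' Q' PQ(3)[of P'] PQ(3)[of Q'] r_bounds ne by linarith+
      then show ?thesis
        using partner[of r] r_sides r_lone by force
    qed
  qed
  have xy_hull: "P \<le> x" "y \<le> Q" "y < length E" using PQ xy M_lt by auto
  show ?thesis
  proof (cases "lone E 0 (length E) r")
    case True
    \<comment> \<open>With \<open>r\<close> outside the segment and just one of \<open>x\<close>,
      \<open>y\<close> inside, the signatures in between sum to 1.\<close>
    then have "\<not> (i \<le> r \<and> r < j)" using False by blast
    then show ?thesis
      using compatible_triple[OF amt True xy(3,4) xy_hull(3) xy(5)] xy_sides xy ij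
      by (intro exI[of _ "\<lambda>k. x < k \<and> k \<le> r \<or> y < k"]) auto
  next
    case not_lone: False
    then obtain n where n: "n < length E" "n \<noteq> r" "E ! n = E ! r"
      using r_bounds by (auto simp: lone_def)
    note sides = r_sides[OF n]
    \<comment> \<open>The range from \<open>x\<close> to \<open>y\<close> lies between
      \<open>P\<close> and \<open>Q\<close>, where \<open>r\<close> is the only occurrence of its
      event.\<close>
    have "n < x \<or> y < n"
      using r_lone[of n] n xy xy_hull M_lt \<open>r \<notin> M\<close>
      by (metis leD le_less_trans less_le_trans nat_le_linear not_less)
    then show ?thesis
    proof
      assume "n < x"
      then show ?thesis
        using compatible_crossing[OF amt, of n x r y] n xy xy_hull xy_sides sides ij
        by (intro exI[of _ "\<lambda>k. n < k \<and> k \<le> x \<or> r < k \<and> k \<le> y"]) auto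
    next
      assume "y < n"
      then show ?thesis
        using compatible_crossing[OF amt, of x r y n] n xy xy_hull xy_sides sides ij
        by (intro exI[of _ "\<lambda>k. x < k \<and> k \<le> r \<or> y < k \<and> k \<le> n"]) auto
    qed
  qed
qed

section \<open>From functions of the index to regions\<close>

lemma compatible_imp_region:
  assumes lin: "linear_ts S E" and b: "compatible E b"
  shows "\<exists>R. region S E R \<and> (\<forall>k\<le>length E. S ! k \<in> R \<longleftrightarrow> b k)"
proof -
  define R where "R = {S ! k | k. k \<le> length E \<and> b k}"
  have R: "S ! k \<in> R \<longleftrightarrow> b k" if "k \<le> length E" for k
    using lin that by (auto simp: R_def linear_ts_def nth_eq_iff_index_eq less_Suc_eq_le)
  define d :: "nat \<Rightarrow> int" where "d m = of_bool (b (Suc m)) - of_bool (b m)" for m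
  \<comment> \<open>Any occurrence of \<open>e\<close> may be chosen, since compatibility makes
    \<open>d\<close> agree on all of them.\<close>
  define sig where "sig e = d (SOME m. m < length E \<and> E ! m = e)" for e
  have sig: "sig (E ! m) = d m" if "m < length E" for m
  proof -
    define n where "n = (SOME n. n < length E \<and> E ! n = E ! m)"
    have "n < length E \<and> E ! n = E ! m"
      unfolding n_def by (rule someI[of _ m]) (use that in simp)
    then have "d n = d m"
      using b that unfolding compatible_def d_def by blast
    then show ?thesis unfolding sig_def n_def .
  qed
  have "R \<subseteq> set S"
    using lin by (auto simp: R_def linear_ts_def)
  moreover have "\<forall>e\<in>set E. sig e \<in> {-1, 0, 1}"
    by (auto simp: in_set_conv_nth sig d_def)
  moreover have "\<forall>i\<in>{1..length E}.
      of_bool (S ! i \<in> R) = of_bool (S ! (i - 1) \<in> R) + sig (E ! (i - 1))"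
  proof
    fix i assume "i \<in> {1..length E}"
    then obtain m where "i = Suc m" "m < length E" by (cases i) auto
    then show "of_bool (S ! i \<in> R) = of_bool (S ! (i - 1) \<in> R) + sig (E ! (i - 1))"
      by (simp add: R sig d_def)
  qed
  ultimately have "region S E R" unfolding region_def by blast
  then show ?thesis using R by blast
qed

section \<open>Parity along exact 2-fold subsequences\<close>

text \<open>A fixed \<open>X\<close> in place of \<open>set xs\<close> keeps the index set unchanged
  during the induction on \<open>xs\<close>.\<close>

lemma sum_list_map_eq_sum_of_nat_count:
  fixes f :: "'a \<Rightarrow> 'b::semiring_1"
  assumes "finite X" "set xs \<subseteq> X"
  shows "sum_list (map f xs) = (\<Sum>x\<in>X. of_nat (count_list xs x) * f x)"
  using assms(2)
proof (induction xs)
  case (Cons y xs)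
  have "(\<Sum>x\<in>X. of_nat (count_list (y # xs) x) * f x) =
      (\<Sum>x\<in>X. (if y = x then f x else 0) + of_nat (count_list xs x) * f x)"
    by (rule sum.cong) (auto simp: algebra_simps)
  also have "\<dots> = f y + sum_list (map f xs)"
    using Cons assms(1) by (simp add: sum.distrib)
  finally show ?case by simp
qed simp

lemma region_exact_two_fold:
  assumes R: "region S E R" and ex: "exact_two_fold_subsequence E i j"
  shows "S ! i \<in> R \<longleftrightarrow> S ! j \<in> R"
proof -
  obtain sig :: "'b \<Rightarrow> int" where sig: "\<And>k. k \<in> {1..length E} \<Longrightarrow>
      of_bool (S ! k \<in> R) = of_bool (S ! (k - 1) \<in> R) + sig (E ! (k - 1))"
    using R unfolding region_def by blast
  let ?L = "subseq_events E i j"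
  have ij: "i < j" "j \<le> length E" and two: "\<And>e. e \<in> set ?L \<Longrightarrow> count_list ?L e = 2"
    using ex unfolding exact_two_fold_subsequence_def by auto
  \<comment> \<open>The region equations telescope; \<open>S ! Suc (i + n)\<close> is entered by the
    event \<open>E ! (i + n)\<close>.\<close>
  have step: "i + n \<le> length E \<Longrightarrow> of_bool (S ! (i + n) \<in> R) =
      of_bool (S ! i \<in> R) + sum_list (map sig (take n (drop i E)))" for n
  proof (induction n)
    case (Suc n)
    then show ?case using sig[of "Suc (i + n)"]
      by (simp add: take_Suc_conv_app_nth)
  qed simp
  have "sum_list (map sig ?L) = (\<Sum>e\<in>set ?L. of_nat (count_list ?L e) * sig e)"
    by (rule sum_list_map_eq_sum_of_nat_count) auto
  also have "\<dots> = 2 * (\<Sum>e\<in>set ?L. sig e)"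
    using two by (simp add: sum_distrib_left)
  finally have "of_bool (S ! j \<in> R) = of_bool (S ! i \<in> R) + 2 * (\<Sum>e\<in>set ?L. sig e)"
    using step[of "j - i"] ij by (simp add: subseq_events_def)
  \<comment> \<open>Two values in {0, 1} that differ by an even integer are equal.\<close>
  then show ?thesis by (cases "S ! i \<in> R"; cases "S ! j \<in> R"; simp; presburger)
qed

theorem theorem5:
  fixes S :: "'s list" and E :: "'e list"
  assumes "linear_ts S E"
    and "two_fold S E"
  shows "state_separation_property S E \<longleftrightarrow>
    \<not> (\<exists>i j. exact_two_fold_subsequence E i j)"
proof
  have len: "length S = Suc (length E)" and dist: "distinct S"
    using assms(1) by (auto simp: linear_ts_def)
  {
    assume ssp: "state_separation_property S E"
    show "\<not> (\<exists>i j. exact_two_fold_subsequence E i j)"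
    proof
      assume "\<exists>i j. exact_two_fold_subsequence E i j"
      then obtain i j where ex: "exact_two_fold_subsequence E i j" by blast
      then have "i < j" "j \<le> length E" by (auto simp: exact_two_fold_subsequence_def)
      then have "S ! i \<in> set S" "S ! j \<in> set S" "S ! i \<noteq> S ! j"
        using len dist by (auto simp: nth_eq_iff_index_eq)
      then obtain R where "region S E R" "(of_bool (S ! i \<in> R) :: int) \<noteq> of_bool (S ! j \<in> R)"
        using ssp unfolding state_separation_property_def by blast
      then show False using region_exact_two_fold[OF _ ex, of S R] by simp
    qed
  next
    assume no: "\<not> (\<exists>i j. exact_two_fold_subsequence E i j)"
    \<comment> \<open>Separation is symmetric in the two states, so ordered indices suffice.\<close>
    have sep: "\<exists>R. region S E R \<and> (S ! i \<in> R) \<noteq> (S ! j \<in> R)"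
      if ij: "i < j" "j \<le> length E" for i j
    proof -
      obtain b where "compatible E b" "b i \<noteq> b j"
        using separating_compatible two_fold_at_most_twice assms ij no by metis
      then show ?thesis
        using compatible_imp_region[OF assms(1)] ij by (metis less_imp_le order_trans)
    qed
    show "state_separation_property S E"
      unfolding state_separation_property_def
    proof (intro ballI impI)
      fix s s' assume "s \<in> set S" "s' \<in> set S" "s \<noteq> s'"
      then obtain i j where "i \<le> length E" "s = S ! i" "j \<le> length E" "s' = S ! j" "i \<noteq> j"
        using len by (metis in_set_conv_nth less_Suc_eq_le)
      then have "\<exists>R. region S E R \<and> (s \<in> R) \<noteq> (s' \<in> R)"
        using sep[of i j] sep[of j i] by (cases "i < j") auto
      then show "\<exists>R. region S E R \<and> (of_bool (s \<in> R) :: int) \<noteq> of_bool (s' \<in> R)"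
        by (simp add: of_bool_eq_iff)
    qed
  }
qed

end
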